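(* Let $H$ be a sparse semigroup of genus $g$ with Frobenius number $\ell_g=2g-(2r+1)$, where $r\in\mathbb{N}$. Then at least one of the following holds: $g\le 4r+1$, or all nongaps of $H$ smaller than $\ell_g$ are even.
   Context: $\mathbb{N}$ is the set of natural numbers including $0$. A numerical semigroup $H\subseteq\mathbb{N}$ of genus $g\ge 1$ is a subset containing $0$, closed under addition, whose complement $\mathbb{N}\setminus H=\{1=\ell_1<\ell_2<\dots<\ell_g\}$ has exactly $g$ elements, called gaps; elements of $H$ are called nongaps and $\ell_g$ is the Frobenius number. $H$ is sparse if $\ell_i-\ell_{i-1}\le 2$ for all $i=2,\dots,g$. *)

theory Defs
  imports Main
begin

definition numerical_semigroup :: "nat set \<Rightarrow> bool" where
  "numerical_semigroup H \<longleftrightarrow>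
     0 \<in> H \<and> (\<forall>x\<in>H. \<forall>y\<in>H. x + y \<in> H) \<and> finite (- H)"

definition gaps :: "nat set \<Rightarrow> nat set" where
  "gaps H = - H"

definition genus :: "nat set \<Rightarrow> nat" where
  "genus H = card (gaps H)"

(* The i-th gap in increasing order, counted from 1: gap H 1 < ... < gap H (genus H).
   The value is meaningful only for 1 \<le> i \<le> genus H. *)
definition gap :: "nat set \<Rightarrow> nat \<Rightarrow> nat" where
  "gap H i = sorted_list_of_set (gaps H) ! (i - 1)"

(* Meaningful only when genus H \<ge> 1. *)
definition frobenius_number :: "nat set \<Rightarrow> nat" where
  "frobenius_number H = gap H (genus H)"

(* Gaps are increasing in the index, so the truncated subtraction is the true difference. *)
definition sparse :: "nat set \<Rightarrow> bool" where
  "sparse H \<longleftrightarrow> (\<forall>i\<in>{2..genus H}. gap H i - gap H (i - 1) \<le> 2)"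

end

theory Submission
  imports Defs
begin

text \<open>
  Let \<open>F\<close> be the (odd) Frobenius number, \<open>N\<close> the number of nongaps below \<open>F\<close> and \<open>U\<close> the set of
  \<open>u \<le> F\<close> such that \<open>u - 1\<close> and \<open>u\<close> are both gaps. Sparsity says that no two nongaps below \<open>F\<close> are
  adjacent, so \<open>{0..F}\<close> is partitioned into the nongaps, their successors and \<open>U\<close>; hence
  \<open>N = g - 2r\<close> and \<open>card U = 2r\<close>, and the claim becomes \<open>N \<le> card U + 1\<close> in the presence of an odd
  nongap \<open>q < F\<close>. Let \<open>x\<close> be the largest even gap below \<open>F\<close> (\<open>F - q\<close> is one) and \<open>m\<close> the
  multiplicity. Between \<open>x\<close> and \<open>F\<close> the nongaps are exactly the even numbers, and looking at \<open>F - m\<close>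
  if \<open>m\<close> is odd, or at the sum of \<open>m\<close> and the largest odd nongap below \<open>F\<close> if \<open>m\<close> is even, one gets
  \<open>F - x \<le> m\<close>. Now \<open>U\<close> contains \<open>{2..m - 1}\<close> and all \<open>x + 1 - h\<close> with \<open>h \<le> x\<close> a nongap. These overlap in at most
  \<open>(m - 1) / 2\<close> points by sparsity, which leaves enough elements.
\<close>

lemma card_no_adjacent_le:
  fixes J :: "nat set"
  assumes "J \<subseteq> {a..<b}" and "\<And>n. n \<in> J \<Longrightarrow> Suc n \<notin> J" and "a \<le> b"
  shows "2 * card J \<le> Suc b - a"
proof -
  have fin: "finite J" using assms(1) finite_subset by blast
  have "J \<inter> Suc ` J = {}" using assms(2) by blast
  then have "card (J \<union> Suc ` J) = 2 * card J"
    using fin by (simp add: card_Un_disjoint card_image)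
  moreover have "J \<union> Suc ` J \<subseteq> {a..<Suc b}" using assms(1) by force
  then have "card (J \<union> Suc ` J) \<le> card {a..<Suc b}" by (intro card_mono) auto
  ultimately show ?thesis by simp
qed

lemma multiplicity_ge_of_odd_nongap:
  fixes H :: "nat set"
  assumes add: "\<And>x y. x \<in> H \<Longrightarrow> y \<in> H \<Longrightarrow> x + y \<in> H"
    and F: "F \<notin> H" "odd F"
    and q: "q \<in> H" "odd q" "q < F"
    and run: "\<And>y. even y \<Longrightarrow> x < y \<Longrightarrow> y < F \<Longrightarrow> y \<in> H"
    and odd_gap: "\<And>y. odd y \<Longrightarrow> x < y \<Longrightarrow> y \<le> F \<Longrightarrow> y \<notin> H"
    and m: "m \<in> H" "0 < m" "m < F"
  shows "F - x \<le> m"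
proof (cases "even m")
  case False
  have "F - m \<notin> H"
  proof
    assume "F - m \<in> H"
    from add[OF this m(1)] show False using F m by simp
  qed
  then have "\<not> x < F - m" using run[of "F - m"] False F m by auto
  then show ?thesis by simp
next
  case True
  define p where "p = Max {y \<in> H. odd y \<and> y < F}"
  have "p \<in> {y \<in> H. odd y \<and> y < F}"
    unfolding p_def using q by (intro Max_in) auto
  then have p: "p \<in> H" "odd p" "p < F" by auto
  have p_max: "y \<le> p" if "y \<in> H" "odd y" "y < F" for y
    unfolding p_def using that by (intro Max_ge) auto
  \<comment> \<open>This odd nongap exceeds \<open>p\<close>, so by maximality of \<open>p\<close>
    it cannot lie below \<open>F\<close>; nor is it the gap \<open>F\<close>.\<close>
  have "p + m \<in> H" "odd (p + m)" using add p m True by auto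
  moreover from this have "\<not> p + m < F" using p_max[of "p + m"] m by auto
  ultimately have "F < p + m" using F by (metis linorder_neqE_nat)
  moreover have "p \<le> x" using odd_gap[of p] p by (meson less_imp_le not_le)
  ultimately show ?thesis by simp
qed

text \<open>This is \<open>card N \<le> card U + 1\<close> with \<open>card U\<close> eliminated
  through \<open>2 * card N + card U = F + 1\<close>.\<close>

lemma card_nongaps_le_of_odd_nongap:
  fixes H :: "nat set"
  assumes zero: "0 \<in> H" and add: "\<And>x y. x \<in> H \<Longrightarrow> y \<in> H \<Longrightarrow> x + y \<in> H"
    and F: "F \<notin> H" "odd F"
    and no_adj: "\<And>n. n \<in> H \<Longrightarrow> Suc n < F \<Longrightarrow> Suc n \<notin> H"
    and q: "q \<in> H" "odd q" "q < F"
  shows "3 * card (H \<inter> {..<F}) \<le> F + 2"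
proof -
  define N where "N = H \<inter> {..<F}"
  define U where "U = {u. 0 < u \<and> u \<le> F \<and> u \<notin> H \<and> u - 1 \<notin> H}"
  define x where "x = Max {y. even y \<and> y \<notin> H \<and> y < F}"
  define m where "m = (LEAST m. m \<in> H \<and> 0 < m)"
  have "F - q \<notin> H"
  proof
    assume "F - q \<in> H"
    from add[OF this q(1)] show False using F q by simp
  qed
  moreover have "even (F - q)" "F - q < F" using F q odd_pos[of q] by simp_all
  ultimately have "F - q \<in> {y. even y \<and> y \<notin> H \<and> y < F}" by simp
  then have "x \<in> {y. even y \<and> y \<notin> H \<and> y < F}"
    unfolding x_def by (intro Max_in) (simp, blast)
  then have x: "even x" "x \<notin> H" "x < F" by auto
  have run: "y \<in> H" if "even y" "x < y" "y < F" for y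
  proof (rule ccontr)
    assume "y \<notin> H"
    then have "y \<le> x" unfolding x_def using that by (intro Max_ge) auto
    then show False using that by simp
  qed
  have odd_gap: "y \<notin> H" if "odd y" "x < y" "y \<le> F" for y
  proof (cases "y = F")
    case False
    have "Suc y \<noteq> F" using that F by auto
    then have "Suc y < F" using that False by simp
    moreover have "Suc y \<in> H" using run[of "Suc y"] calculation that by simp
    ultimately show ?thesis using no_adj by blast
  qed (use F in simp)
  have m: "m \<in> H" "0 < m"
    unfolding m_def using LeastI[of "\<lambda>m. m \<in> H \<and> 0 < m" q] q odd_pos[of q] by simp_all
  have m_le: "m \<le> y" if "y \<in> H" "0 < y" for y
    unfolding m_def using that by (intro Least_le) simp
  have mF: "m < F" using m_le[of q] q odd_pos[of q] by simp
  have "m \<noteq> 1" using no_adj[OF zero] m mF by auto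
  then have m2: "2 \<le> m" using m by simp
  have Fx: "F - x \<le> m"
    using multiplicity_ge_of_odd_nongap[OF add F q run odd_gap m mF] by blast

  have "card N + card (Suc ` N) + card U = card (N \<union> Suc ` N \<union> U)"
  proof -
    have "N \<inter> Suc ` N = {}" using no_adj by (auto simp: N_def)
    moreover have "(N \<union> Suc ` N) \<inter> U = {}" by (auto simp: N_def U_def)
    moreover have "finite N" "finite U" by (auto simp: N_def U_def)
    ultimately show ?thesis by (simp add: card_Un_disjoint)
  qed
  also have "N \<union> Suc ` N \<union> U = {..F}"
  proof (intro set_eqI iffI)
    fix y assume y: "y \<in> {..F}"
    show "y \<in> N \<union> Suc ` N \<union> U"
    proof (cases y)
      case 0
      then show ?thesis using zero mF by (auto simp: N_def)
    next
      case (Suc z)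
      then show ?thesis using y F(1)
        by (cases "z \<in> H"; cases "y = F") (auto simp: N_def U_def)
    qed
  qed (auto simp: N_def U_def)
  finally have part: "2 * card N + card U = F + 1" by (simp add: card_image)

  define A where "A = H \<inter> {..x}"
  \<comment> \<open>\<open>J\<close> collects the \<open>h\<close> in \<open>A\<close> whose
    reflection \<open>x + 1 - h\<close> falls into \<open>{2..<m}\<close>, where it would be counted
    twice.\<close>
  define J where "J = H \<inter> {x + 2 - m..<x}"
  define E where "E = {y. even y \<and> x < y \<and> y < F}"
  have "N = A \<union> E" using run odd_gap x by (force simp: N_def A_def E_def)
  moreover have "A \<inter> E = {}" "finite A" "finite E" by (auto simp: A_def E_def)
  ultimately have N: "card N = card A + card E" by (simp add: card_Un_disjoint)
  have "2 * card E \<le> Suc F - Suc x"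
    by (rule card_no_adjacent_le) (use x in \<open>auto simp: E_def\<close>)
  moreover have "even (F - x - 1)" using F x by simp
  ultimately have E: "2 * card E \<le> F - x" by simp
  have "2 * card J \<le> Suc x - (x + 2 - m)"
    by (rule card_no_adjacent_le) (use no_adj x m2 in \<open>auto simp: J_def\<close>)
  then have J: "2 * card J \<le> m - 1" by simp

  have "{2..<m} \<union> (\<lambda>h. x + 1 - h) ` (A - J) \<subseteq> U"
  proof (intro Un_least subsetI)
    fix u assume "u \<in> {2..<m}"
    then show "u \<in> U" using m_le[of u] m_le[of "u - 1"] mF by (auto simp: U_def)
  next
    fix u assume "u \<in> (\<lambda>h. x + 1 - h) ` (A - J)"
    then obtain h where h: "h \<in> H" "h \<le> x" "u = x + 1 - h" by (auto simp: A_def)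
    \<comment> \<open>Both \<open>x\<close> and \<open>x + 1\<close> are gaps, and subtracting a
      nongap \<open>h\<close> from a gap leaves a gap.\<close>
    have "x + 1 \<notin> H" using odd_gap[of "x + 1"] x by simp
    then have "x + 1 - h \<notin> H" using add[of "x + 1 - h" h] h by auto
    moreover have "x - h \<notin> H" using add[of "x - h" h] h x by auto
    ultimately show "u \<in> U" using h x by (simp add: U_def)
  qed
  moreover have "finite U" by (simp add: U_def)
  ultimately have "card ({2..<m} \<union> (\<lambda>h. x + 1 - h) ` (A - J)) \<le> card U"
    by (rule card_mono[rotated])
  moreover have "{2..<m} \<inter> (\<lambda>h. x + 1 - h) ` (A - J) = {}"
  proof -
    have "h \<in> J" if "h \<in> A" "2 \<le> x + 1 - h" "x + 1 - h < m" for h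
      using that by (auto simp: A_def J_def)
    then show ?thesis by fastforce
  qed
  moreover have "card ((\<lambda>h. x + 1 - h) ` (A - J)) = card (A - J)"
    by (intro card_image inj_onI) (auto simp: A_def)
  moreover have "card (A - J) = card A - card J" "card J \<le> card A"
    using \<open>finite A\<close> by (auto simp: A_def J_def intro!: card_Diff_subset card_mono)
  ultimately have "(m - 2) + (card A - card J) \<le> card U" "card J \<le> card A"
    using \<open>finite A\<close> by (simp_all add: card_Un_disjoint)
  \<comment> \<open>From \<open>2 * (card E + card J) \<le> 2 * m - 1\<close> one gets
    \<open>card E + card J \<le> (m - 2) + 1\<close> by integrality.\<close>
  then have "card N \<le> card U + 1" using N E J Fx m2 by linarith
  then show ?thesis using part by (simp add: N_def)
qed

lemma frobenius_number_max_gap: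
  assumes "numerical_semigroup H" and "genus H \<ge> 1"
  shows "frobenius_number H \<notin> H" and "\<And>n. frobenius_number H < n \<Longrightarrow> n \<in> H"
proof -
  let ?l = "sorted_list_of_set (- H)"
  have fin: "finite (- H)" using assms(1) by (simp add: numerical_semigroup_def)
  have len: "length ?l = genus H" by (simp add: genus_def gaps_def)
  have F: "frobenius_number H = ?l ! (genus H - 1)"
    by (simp add: frobenius_number_def gap_def gaps_def)
  have "?l ! (genus H - 1) \<in> set ?l" using len assms(2) by (intro nth_mem) simp
  then show "frobenius_number H \<notin> H" using fin F by simp
  fix n assume n: "frobenius_number H < n"
  show "n \<in> H"
  proof (rule ccontr)
    assume "n \<notin> H"
    then have "n \<in> set ?l" using fin by simp
    then obtain i where i: "i < genus H" "?l ! i = n" using len by (metis in_set_conv_nth)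
    then have "?l ! i \<le> ?l ! (genus H - 1)" by (intro sorted_nth_mono) (use len in auto)
    then show False using n i F by simp
  qed
qed

text \<open>Two adjacent nongaps have the gap 1 below and the Frobenius number above them, so the
  consecutive gaps enclosing them would differ by at least 3.\<close>

lemma sparse_no_adjacent_nongaps:
  assumes H: "numerical_semigroup H" and "genus H \<ge> 1" and sp: "sparse H"
    and n: "n \<in> H" "Suc n < frobenius_number H"
  shows "Suc n \<notin> H"
proof
  assume Sn: "Suc n \<in> H"
  let ?l = "sorted_list_of_set (- H)"
  have fin: "finite (- H)" using H by (simp add: numerical_semigroup_def)
  have len: "length ?l = genus H" by (simp add: genus_def gaps_def)
  have gap: "gap H i = ?l ! (i - 1)" for i by (simp add: gap_def gaps_def)
  have one: "1 \<notin> H"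
  proof
    assume "1 \<in> H"
    have "k \<in> H" for k
    proof (induction k)
      case (Suc k)
      then have "k + 1 \<in> H" using H \<open>1 \<in> H\<close> unfolding numerical_semigroup_def by blast
      then show ?case by simp
    qed (use H in \<open>simp add: numerical_semigroup_def\<close>)
    then show False using frobenius_number_max_gap(1)[OF assms(1,2)] by blast
  qed
  \<comment> \<open>The first gap beyond \<open>Suc n\<close>, at a list index counted from 0; it is
    \<open>gap H (Suc i)\<close>.\<close>
  define i where "i = (LEAST i. Suc n < ?l ! i)"
  have last: "Suc n < ?l ! (genus H - 1)" using n(2) gap by (simp add: frobenius_number_def)
  have i: "Suc n < ?l ! i" unfolding i_def using last by (rule LeastI)
  have ig: "i \<le> genus H - 1" unfolding i_def using last by (rule Least_le)
  have "i \<noteq> 0"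
  proof
    assume "i = 0"
    obtain j where "j < length ?l" "?l ! j = 1"
      using one fin by (metis ComplI in_set_conv_nth set_sorted_list_of_set)
    then have "?l ! 0 \<le> 1" using sorted_nth_mono[of ?l 0 j] by simp
    then show False using i \<open>i = 0\<close> by simp
  qed
  then have "\<not> Suc n < ?l ! (i - 1)" unfolding i_def by (intro not_less_Least) simp
  moreover have "?l ! (i - 1) \<in> set ?l" using ig len assms(2) by (intro nth_mem) simp
  then have "?l ! (i - 1) \<notin> H" using fin by simp
  ultimately have "?l ! (i - 1) < n"
    using n(1) Sn by (metis less_Suc_eq linorder_neqE_nat)
  moreover have "gap H (Suc i) - gap H (Suc i - 1) \<le> 2"
    by (rule bspec[OF sp[unfolded sparse_def]]) (use \<open>i \<noteq> 0\<close> ig assms(2) in auto)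
  ultimately show False using i by (simp add: gap)
qed

theorem corollary3p11:
  fixes H :: "nat set" and g r :: nat
  assumes "numerical_semigroup H"
    and "genus H = g"
    and "g \<ge> 1"
    and "sparse H"
    and "int (frobenius_number H) = 2 * int g - (2 * int r + 1)"
  shows "g \<le> 4 * r + 1 \<or> (\<forall>n\<in>H. n < frobenius_number H \<longrightarrow> even n)"
proof (rule disjCI)
  let ?F = "frobenius_number H"
  assume "\<not> (\<forall>n\<in>H. n < ?F \<longrightarrow> even n)"
  then obtain q where q: "q \<in> H" "odd q" "q < ?F" by blast
  have g: "genus H \<ge> 1" using assms by simp
  note F = frobenius_number_max_gap[OF assms(1) g]
  have Fg: "?F + 2 * r + 1 = 2 * g" using assms(5) by linarith
  then have "odd ?F" by presburger
  have "3 * card (H \<inter> {..<?F}) \<le> ?F + 2"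
    using card_nongaps_le_of_odd_nongap[OF _ _ F(1) \<open>odd ?F\<close> _ q]
      sparse_no_adjacent_nongaps[OF assms(1) g assms(4)] assms(1)
    by (auto simp: numerical_semigroup_def)
  moreover have "card (H \<inter> {..<?F}) + g = ?F + 1"
  proof -
    have "{..?F} = (H \<inter> {..<?F}) \<union> - H"
    proof (rule set_eqI)
      show "y \<in> {..?F} \<longleftrightarrow> y \<in> (H \<inter> {..<?F}) \<union> - H" for y
        using F by (cases y ?F rule: linorder_cases) auto
    qed
    moreover have "card ((H \<inter> {..<?F}) \<union> - H) = card (H \<inter> {..<?F}) + card (- H)"
      by (rule card_Un_disjoint) (use assms(1) in \<open>auto simp: numerical_semigroup_def\<close>)
    ultimately show ?thesis using assms(2) by (metis Suc_eq_plus1 card_atMost genus_def gaps_def)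
  qed
  \<comment> \<open>Substituting \<open>?F + 1 - g\<close> for the number of nongaps gives
    \<open>2 * ?F + 1 \<le> 3 * g\<close>, where \<open>2 * ?F = 4 * g - 4 * r - 2\<close>.\<close>
  ultimately show "g \<le> 4 * r + 1" using Fg by linarith
qed

end
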